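(* Let $n,d\ge 1$ be integers, $\lambda>0$, and let $\boldsymbol{x}_1,\dots,\boldsymbol{x}_n\in\mathbb{R}^d$, $y_1,\dots,y_n\in\{+1,-1\}$. For each $\tau\in[0,1]$ consider the dual of the quantile classification problem, $$\min_{\boldsymbol{\alpha}\in\mathbb{R}^n}\ D(\boldsymbol{\alpha}) := \frac{1}{2\lambda}\boldsymbol{\alpha}^\top Q\boldsymbol{\alpha}-\boldsymbol{\alpha}^\top\mathbf{1}\quad\text{subject to}\quad 0\le\alpha_i\le c_{y_i}^\tau\ \text{ for all } i=1,\dots,n,$$ where $Q\in\mathbb{R}^{n\times n}$ has entries $Q_{ij}=y_iy_j\boldsymbol{x}_i^\top\boldsymbol{x}_j$, $\mathbf{1}$ is the all-ones vector, and $c_{+1}^\tau = 2(1-\tau)/n$, $c_{-1}^\tau = 2\tau/n$. Then there exist a finite set of quantiles $0=\tau_1<\tau_2<\dots<\tau_K=1$ and a map $[0,1]\to\mathbb{R}^n$, $\tau\mapsto\boldsymbol{\alpha}^\tau$, such that: (i) for every $\tau\in[0,1]$, $\boldsymbol{\alpha}^\tau$ is an optimal solution of the problem of minimizing $D(\boldsymbol{\alpha})$ over $\boldsymbol{\alpha}\in\mathbb{R}^n$ subject to $0\le\alpha_i\le c_{y_i}^\tau$ for all $i=1,\dots,n$; (ii) $\boldsymbol{\alpha}^\tau$ is continuous in $\tau$ on $[0,1]$; (iii) for each $k=1,\dots,K-1$, $\boldsymbol{\alpha}^\tau$ is linear in $\tau$ for $\tau\in(\tau_k,\tau_{k+1}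)$.
   Context: "Linear in $\tau$" on an interval means affine: $\boldsymbol{\alpha}^\tau=\boldsymbol{a}+\tau\boldsymbol{b}$ on that interval for some constant vectors $\boldsymbol{a},\boldsymbol{b}\in\mathbb{R}^n$. The matrix $Q$ is symmetric positive semidefinite and may be singular, so optimal solutions need not be unique. The problem is the Lagrangian dual of the asymmetric-cost SVM problem $\min_{\boldsymbol{w}\in\mathbb{R}^d}\frac{\lambda}{2}\|\boldsymbol{w}\|^2+\sum_{i=1}^n c_{y_i}^\tau\max(0,1-y_i\boldsymbol{w}^\top\boldsymbol{x}_i)$. *)

theory Defs
  imports "HOL-Analysis.Analysis"
begin

text \<open>
  The samples are indexed by the finite type \<open>'n\<close>, so the sample size is \<open>CARD('n)\<close>;
  a label is one of the reals \<open>1\<close> and \<open>-1\<close>.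
\<close>

definition dual_matrix :: "('n::finite \<Rightarrow> real^'d) \<Rightarrow> ('n \<Rightarrow> real) \<Rightarrow> real^'n^'n" where
  "dual_matrix x y = (\<chi> i j. y i * y j * (x i \<bullet> x j))"

definition dual_objective ::
  "real \<Rightarrow> ('n::finite \<Rightarrow> real^'d) \<Rightarrow> ('n \<Rightarrow> real) \<Rightarrow> real^'n \<Rightarrow> real" where
  "dual_objective lam x y \<alpha> =
     1 / (2 * lam) * (\<alpha> \<bullet> (dual_matrix x y *v \<alpha>)) - \<alpha> \<bullet> (\<chi> i. 1)"

text \<open>The second branch is only meant for the label \<open>-1\<close>.\<close>

definition class_cost :: "nat \<Rightarrow> real \<Rightarrow> real \<Rightarrow> real" where
  "class_cost n \<tau> l = (if l = 1 then 2 * (1 - \<tau>) / real n else 2 * \<tau> / real n)"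

definition dual_feasible :: "('n::finite \<Rightarrow> real) \<Rightarrow> real \<Rightarrow> (real^'n) set" where
  "dual_feasible y \<tau> = {\<alpha>. \<forall>i. 0 \<le> \<alpha> $ i \<and> \<alpha> $ i \<le> class_cost CARD('n) \<tau> (y i)}"

definition dual_optimal ::
  "real \<Rightarrow> ('n::finite \<Rightarrow> real^'d) \<Rightarrow> ('n \<Rightarrow> real) \<Rightarrow> real \<Rightarrow> real^'n \<Rightarrow> bool" where
  "dual_optimal lam x y \<tau> \<alpha> \<longleftrightarrow>
     is_arg_min (dual_objective lam x y) (\<lambda>\<beta>. \<beta> \<in> dual_feasible y \<tau>) \<alpha>"

end

theory Submission
  imports Defs
begin

text \<open>
  The optimality conditions say that a feasible \<open>\<alpha>\<close> is optimal iff the partial derivatives of the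
  objective that are positive (negative) occur at coordinates on the lower (upper) bound. Prescribing
  these coordinates cuts out a compact convex set of pairs \<open>(\<tau>, \<alpha>)\<close>; there are finitely many such
  sets and their projections to the parameter are intervals covering \<open>[0, 1]\<close>. Take the end points of
  these intervals as breakpoints, so that between two consecutive breakpoints some affine path
  of optimal solutions exists. As the objective is \<open>c\<parallel>W \<alpha>\<parallel>\<^sup>2 - h \<bullet> \<alpha>\<close>, all optimal solutions at a
  given parameter share the values of \<open>W \<alpha>\<close> and \<open>h \<bullet> \<alpha>\<close>. Hence \<^emph>\<open>arbitrary\<close> optimal solutions
  chosen at the breakpoints have an optimal linear interpolation.
\<close>

section \<open>Piecewise linear interpolation\<close>

text \<open>Cut at all end points of the covering intervals. A member meeting the open gap between
  neighbouring cuts has no end point inside the gap, so it spans the gap; being closed, it also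
  contains both cuts.\<close>

lemma finite_interval_cover_partition:
  fixes \<C> :: "real set set"
  assumes fin: "finite \<C>"
    and \<C>: "\<And>C. C \<in> \<C> \<Longrightarrow> compact C \<and> convex C \<and> C \<subseteq> {a..b}"
    and cover: "{a..b} \<subseteq> \<Union>\<C>"
    and "a < b"
  obtains K :: nat and t :: "nat \<Rightarrow> real"
  where "2 \<le> K" "t 1 = a" "t K = b" "strict_mono_on {1..K} t"
    "\<And>k. k \<in> {1..K-1} \<Longrightarrow> \<exists>C\<in>\<C>. {t k..t (k+1)} \<subseteq> C"
proof -
  \<comment> \<open>Empty members are dropped because \<open>Inf {}\<close> and
    \<open>Sup {}\<close> are no end points; \<open>a\<close> and \<open>b\<close> are added so that
    they become the first and last cut.\<close>
  define E where "E = {a, b} \<union> (Inf ` (\<C> - {{}}) \<union> Sup ` (\<C> - {{}}))"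
  have finE: "finite E"
    using fin by (simp add: E_def)
  have ends: "Inf C \<in> C \<and> Sup C \<in> C" if "C \<in> \<C>" "C \<noteq> {}" for C
    using that \<C>[of C]
    by (meson closed_contains_Inf closed_contains_Sup compact_eq_bounded_closed
        bounded_imp_bdd_above bounded_imp_bdd_below)
  have E_sub: "E \<subseteq> {a..b}"
    unfolding E_def using ends \<C> \<open>a < b\<close> by fastforce
  define xs where "xs = sorted_list_of_set E"
  \<comment> \<open>Shifts the zero-based list to breakpoints numbered from 1.\<close>
  define t where "t k = xs ! (k - 1)" for k :: nat
  define K where "K = length xs"
  have set_xs: "set xs = E" and sorted_xs: "sorted_wrt (<) xs"
    using finE by (auto simp: xs_def)
  have mono: "xs ! i < xs ! j" if "i < j" "j < K" for i j
    using sorted_xs that by (simp add: K_def sorted_wrt_iff_nth_less)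
  have nth_E: "xs ! i \<in> E" if "i < K" for i
    using set_xs that by (auto simp: K_def)
  have E_nth: "\<exists>i<K. xs ! i = e" if "e \<in> E" for e
    using set_xs that by (metis K_def in_set_conv_nth)
  have "card {a, b} \<le> card E"
    using finE by (intro card_mono) (auto simp: E_def)
  then have K2: "2 \<le> K"
    using \<open>a < b\<close> by (simp add: K_def xs_def)
  have t1: "t 1 = a"
  proof -
    obtain i where i: "i < K" "xs ! i = a"
      using E_nth[of a] by (auto simp: E_def)
    have "a \<le> xs ! 0"
      using nth_E[of 0] E_sub K2 by fastforce
    with i mono[of 0 i] have "i = 0"
      by fastforce
    with i show ?thesis
      by (simp add: t_def)
  qed
  have tK: "t K = b"
  proof -
    obtain i where i: "i < K" "xs ! i = b"
      using E_nth[of b] by (auto simp: E_def)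
    have "xs ! (K - 1) \<le> b"
      using nth_E[of "K - 1"] E_sub K2 by fastforce
    with i mono[of i "K - 1"] have "i = K - 1"
      by fastforce
    with i show ?thesis
      by (simp add: t_def)
  qed
  have strict: "strict_mono_on {1..K} t"
    unfolding t_def by (auto intro!: strict_mono_onI mono)
  have "\<exists>C\<in>\<C>. {t k..t (k+1)} \<subseteq> C" if k: "k \<in> {1..K-1}" for k
  proof -
    have k': "k - 1 < K" "k < K" "1 \<le> k"
      using k K2 by auto
    have less: "t k < t (k+1)"
      using k K2 by (intro strict_mono_onD[OF strict]) auto
    \<comment> \<open>A point strictly inside the gap: a member covering only a breakpoint might
      touch the gap without spanning it.\<close>
    define m where "m = (t k + t (k+1)) / 2"
    have m: "t k < m" "m < t (k+1)"
      using less by (auto simp: m_def)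
    have "t k \<in> {a..b}" "t (k+1) \<in> {a..b}"
      using subsetD[OF E_sub nth_E[of "k-1"]] subsetD[OF E_sub nth_E[of k]] k K2
      by (auto simp: t_def)
    then have "m \<in> {a..b}"
      using m by auto
    then obtain C where C: "C \<in> \<C>" "m \<in> C"
      using cover by blast
    then have bdd: "bdd_below C" "bdd_above C" and E: "Inf C \<in> E" "Sup C \<in> E"
      using \<C>[of C] by (auto simp: E_def compact_imp_bounded bounded_imp_bdd_above bounded_imp_bdd_below)
    have le: "Inf C \<le> m" "m \<le> Sup C"
      using C bdd by (auto intro: cInf_lower cSup_upper)
    obtain i where i: "i < K" "xs ! i = Inf C"
      using E_nth E by metis
    obtain j where j: "j < K" "xs ! j = Sup C"
      using E_nth E by metis
    \<comment> \<open>\<open>Inf C\<close> is itself an entry of \<open>xs\<close>; if it lay beyond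
      \<open>t k\<close>, its index would be at least \<open>k\<close>, hence \<open>Inf C\<close>
      at least \<open>t (k+1)\<close>, which exceeds \<open>m\<close>.\<close>
    have "Inf C \<le> t k"
    proof (rule ccontr)
      assume "\<not> Inf C \<le> t k"
      then have "\<not> i \<le> k - 1"
        using i k' mono[of i "k-1"] by (cases "i = k - 1") (auto simp: t_def)
      then have "k \<le> i"
        using k' by simp
      then have "t (k+1) \<le> Inf C"
        using i mono[of k i] by (cases "i = k") (auto simp: t_def)
      with le m show False by simp
    qed
    moreover have "t (k+1) \<le> Sup C"
    proof (rule ccontr)
      assume "\<not> t (k+1) \<le> Sup C"
      then have "\<not> k \<le> j"
        using j k' mono[of k j] by (cases "k = j") (auto simp: t_def)
      then have "j \<le> k - 1"
        using k' by simp
      then have "Sup C \<le> t k"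
        using j k' mono[of j "k-1"] by (cases "j = k-1") (auto simp: t_def)
      with le m show False by simp
    qed
    ultimately have "{t k..t (k+1)} \<subseteq> {Inf C..Sup C}"
      by auto
    also have "\<dots> \<subseteq> C"
      using \<C>[OF C(1)] ends[OF C(1)] C(2)
      by (metis empty_iff interval_subset_is_interval is_interval_convex_1 box_real(2))
    finally show ?thesis
      using C by blast
  qed
  with K2 t1 tK strict show thesis
    by (rule that)
qed

text \<open>A single sum of clamped increments instead of a case distinction over segments:
  continuity needs no gluing at the breakpoints.\<close>

definition pl_interp :: "nat \<Rightarrow> (nat \<Rightarrow> real) \<Rightarrow> (nat \<Rightarrow> 'a::real_normed_vector) \<Rightarrow> real \<Rightarrow> 'a" where
  "pl_interp K t v \<tau> =
     v 1 + (\<Sum>j=1..<K. max 0 (min 1 ((\<tau> - t j) / (t (j+1) - t j))) *\<^sub>R (v (j+1) - v j))"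

lemma continuous_on_pl_interp: "continuous_on S (pl_interp K t v)"
  unfolding pl_interp_def divide_inverse by (intro continuous_intros)

text \<open>Completed segments have clamp value 1 and telescope to \<open>v k - v 1\<close>; later
  segments have clamp value 0.\<close>

lemma pl_interp_eq:
  assumes mono: "strict_mono_on {1..K} t" and k: "k \<in> {1..<K}" and \<tau>: "\<tau> \<in> {t k..t (k+1)}"
  shows "pl_interp K t v \<tau> = v k + ((\<tau> - t k) / (t (k+1) - t k)) *\<^sub>R (v (k+1) - v k)"
proof -
  define r where "r j = max 0 (min 1 ((\<tau> - t j) / (t (j+1) - t j)))" for j
  have step: "t j < t (j+1)" if "j \<in> {1..<K}" for j
    using that by (intro strict_mono_onD[OF mono]) auto
  have le: "t i \<le> t j" if "1 \<le> i" "i \<le> j" "j \<le> K" for i j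
    using that strict_mono_on_leD[OF mono, of i j] by auto
  have r1: "r j = 1" if j: "j \<in> {1..<k}" for j
  proof -
    have "t (j+1) \<le> \<tau>"
      using le[of "j+1" k] j k \<tau> by auto
    then show ?thesis
      using step[of j] j k by (simp add: r_def)
  qed
  have r0: "r j = 0" if j: "j \<in> {k+1..<K}" for j
  proof -
    have "\<tau> \<le> t j"
      using le[of "k+1" j] j k \<tau> by auto
    then have "(\<tau> - t j) / (t (j+1) - t j) \<le> 0"
      using step[of j] j k by (intro divide_nonpos_pos) auto
    then show ?thesis
      by (simp add: r_def)
  qed
  have rk: "r k = (\<tau> - t k) / (t (k+1) - t k)"
    using step[of k] k \<tau> by (simp add: r_def)
  have split: "{1..<K} = {1..<k} \<union> insert k {k+1..<K}"
    using k by auto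
  have "(\<Sum>j=1..<K. r j *\<^sub>R (v (j+1) - v j))
      = (\<Sum>j=1..<k. r j *\<^sub>R (v (j+1) - v j)) + r k *\<^sub>R (v (k+1) - v k)
        + (\<Sum>j=k+1..<K. r j *\<^sub>R (v (j+1) - v j))"
    unfolding split by (subst sum.union_disjoint) auto
  also have "(\<Sum>j=k+1..<K. r j *\<^sub>R (v (j+1) - v j)) = 0"
    using r0 by (intro sum.neutral) auto
  also have "(\<Sum>j=1..<k. r j *\<^sub>R (v (j+1) - v j)) = (\<Sum>j=1..<k. v (Suc j) - v j)"
    using r1 by (intro sum.cong) auto
  also have "\<dots> = v k - v 1"
    using k by (simp add: sum_Suc_diff')
  finally show ?thesis
    unfolding pl_interp_def r_def[symmetric] by (simp add: rk)
qed

section \<open>Box-constrained convex quadratic programs with an affine upper bound\<close>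

text \<open>Factoring the quadratic form through \<open>W\<close> makes it convex by construction; a
  noninjective \<open>W\<close> covers the singular case.\<close>

locale parametric_box_qp =
  fixes W :: "real^'n::finite \<Rightarrow> 'b::real_inner"
    and c :: real
    and h u0 u1 :: "real^'n"
  assumes linear_W: "linear W"
    and c_pos: "c > 0"
    and upper_nonneg: "\<And>\<tau> i. \<tau> \<in> {0..1} \<Longrightarrow> 0 \<le> (u0 + \<tau> *\<^sub>R u1) $ i"
begin

section \<open>Objective, feasible box and exact quadratic expansion\<close>

definition obj :: "real^'n \<Rightarrow> real" where
  "obj \<alpha> = c * (W \<alpha> \<bullet> W \<alpha>) - h \<bullet> \<alpha>"

text \<open>The partial derivative of \<open>obj\<close> in coordinate \<open>i\<close>. It is
  affine in \<alpha>, so nonstrict sign conditions on it define closed convex sets.\<close>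

definition grad :: "real^'n \<Rightarrow> 'n \<Rightarrow> real" where
  "grad \<alpha> i = 2 * c * (W \<alpha> \<bullet> W (axis i 1)) - h $ i"

definition feas :: "real \<Rightarrow> (real^'n) set" where
  "feas \<tau> = {\<alpha>. \<forall>i. 0 \<le> \<alpha> $ i \<and> \<alpha> $ i \<le> (u0 + \<tau> *\<^sub>R u1) $ i}"

definition opt :: "real \<Rightarrow> real^'n \<Rightarrow> bool" where
  "opt \<tau> = is_arg_min obj (\<lambda>\<beta>. \<beta> \<in> feas \<tau>)"

lemma opt_iff: "opt \<tau> \<alpha> \<longleftrightarrow> \<alpha> \<in> feas \<tau> \<and> (\<forall>\<beta>\<in>feas \<tau>. obj \<alpha> \<le> obj \<beta>)"
  by (auto simp: opt_def is_arg_min_linorder)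

lemma W_simps: "W (\<alpha> + \<beta>) = W \<alpha> + W \<beta>" "W (\<alpha> - \<beta>) = W \<alpha> - W \<beta>" "W (r *\<^sub>R \<alpha>) = r *\<^sub>R W \<alpha>"
  using linear_W by (auto simp: linear_add linear_diff linear_scale)

lemma continuous_on_W [continuous_intros]:
  "continuous_on S f \<Longrightarrow> continuous_on S (\<lambda>z. W (f z))"
  using linear_W by (simp add: linear_conv_bounded_linear bounded_linear.continuous_on)

text \<open>The second-order Taylor expansion of a quadratic is exact. Its nonnegative remainder
  makes the first-order conditions sufficient.\<close>

lemma obj_add: "obj (\<alpha> + \<delta>) = obj \<alpha> + (\<Sum>i\<in>UNIV. grad \<alpha> i * \<delta> $ i) + c * (W \<delta> \<bullet> W \<delta>)"
proof -
  have "W \<delta> = W (\<Sum>i\<in>UNIV. \<delta> $ i *\<^sub>R axis i 1)"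
    using basis_expansion[of \<delta>] by (simp add: scalar_mult_eq_scaleR)
  also have "\<dots> = (\<Sum>i\<in>UNIV. \<delta> $ i *\<^sub>R W (axis i 1))"
    using linear_W by (simp add: linear_sum W_simps)
  finally have "W \<alpha> \<bullet> W \<delta> = (\<Sum>i\<in>UNIV. \<delta> $ i * (W \<alpha> \<bullet> W (axis i 1)))"
    by (simp add: inner_sum_right)
  then have "2 * c * (W \<alpha> \<bullet> W \<delta>) - h \<bullet> \<delta>
      = (\<Sum>i\<in>UNIV. 2 * c * (\<delta> $ i * (W \<alpha> \<bullet> W (axis i 1))) - h $ i * \<delta> $ i)"
    by (simp add: sum_subtractf sum_distrib_left inner_vec_def)
  also have "\<dots> = (\<Sum>i\<in>UNIV. grad \<alpha> i * \<delta> $ i)"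
    by (intro sum.cong) (simp_all add: grad_def algebra_simps)
  finally have "(\<Sum>i\<in>UNIV. grad \<alpha> i * \<delta> $ i) = 2 * c * (W \<alpha> \<bullet> W \<delta>) - h \<bullet> \<delta>" ..
  then show ?thesis
    by (simp add: obj_def W_simps inner_add_left inner_add_right inner_commute algebra_simps)
qed

lemma obj_add_axis: "obj (\<alpha> + s *\<^sub>R axis i 1)
    = obj \<alpha> + s * (grad \<alpha> i + s * (c * (W (axis i 1) \<bullet> W (axis i 1))))"
proof -
  have "(\<Sum>j\<in>UNIV. grad \<alpha> j * (s *\<^sub>R axis i 1) $ j) = (\<Sum>j\<in>UNIV. if j = i then s * grad \<alpha> i else 0)"
    by (intro sum.cong) (auto simp: axis_def)
  then show ?thesis
    by (simp add: obj_add W_simps algebra_simps)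
qed

text \<open>The upper bound is affine in the parameter, so feasibility is convex jointly in
  parameter and point, not only for a fixed parameter.\<close>

lemma convex_feas:
  assumes "\<alpha> \<in> feas \<sigma>" "\<beta> \<in> feas \<tau>" "0 \<le> p" "0 \<le> q" "p + q = 1"
  shows "p *\<^sub>R \<alpha> + q *\<^sub>R \<beta> \<in> feas (p * \<sigma> + q * \<tau>)"
proof -
  have "0 \<le> p * \<alpha> $ i + q * \<beta> $ i \<and>
      p * \<alpha> $ i + q * \<beta> $ i \<le> u0 $ i + (p * \<sigma> + q * \<tau>) * u1 $ i" for i
  proof -
    have "p * \<alpha> $ i + q * \<beta> $ i \<le> p * (u0 $ i + \<sigma> * u1 $ i) + q * (u0 $ i + \<tau> * u1 $ i)"
      using assms by (intro add_mono mult_left_mono) (auto simp: feas_def)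
    also have "\<dots> = (p + q) * u0 $ i + (p * \<sigma> + q * \<tau>) * u1 $ i"
      by (simp add: algebra_simps)
    finally show ?thesis
      using assms by (auto simp: feas_def)
  qed
  then show ?thesis
    by (simp add: feas_def)
qed

section \<open>Existence of optimal solutions and what they share\<close>

lemma opt_exists:
  assumes "\<tau> \<in> {0..1}"
  obtains \<alpha> where "opt \<tau> \<alpha>"
proof -
  have feas: "feas \<tau> = cbox 0 (u0 + \<tau> *\<^sub>R u1)"
    by (auto simp: feas_def mem_box_cart)
  have "0 \<in> feas \<tau>"
    using upper_nonneg[OF assms] by (auto simp: feas_def)
  moreover have "continuous_on (feas \<tau>) obj"
    unfolding obj_def[abs_def] by (intro continuous_intros)
  ultimately obtain \<alpha> where "\<alpha> \<in> feas \<tau>" "\<forall>\<beta>\<in>feas \<tau>. obj \<alpha> \<le> obj \<beta>"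
    using continuous_attains_inf[of "feas \<tau>" obj] feas compact_cbox by (metis empty_iff)
  then show thesis
    using that by (simp add: opt_iff)
qed

text \<open>The midpoint of two optimal points is feasible. By the parallelogram identity its
  objective is below the common minimum by a positive multiple of the squared distance of
  \<open>W \<alpha>\<close> and \<open>W \<beta>\<close>, which must therefore vanish.\<close>

lemma opt_unique:
  assumes "opt \<tau> \<alpha>" "opt \<tau> \<beta>"
  shows "W \<alpha> = W \<beta>" "h \<bullet> \<alpha> = h \<bullet> \<beta>"
proof -
  have eq: "obj \<alpha> = obj \<beta>"
    using assms by (auto simp: opt_iff intro: antisym)
  define \<mu> where "\<mu> = (1/2) *\<^sub>R \<alpha> + (1/2) *\<^sub>R \<beta>"
  have "\<mu> \<in> feas \<tau>"
    using convex_feas[of \<alpha> \<tau> \<beta> \<tau> "1/2" "1/2"] assms by (simp add: opt_iff \<mu>_def)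
  then have "obj \<alpha> \<le> obj \<mu>"
    using assms by (auto simp: opt_iff)
  also have "obj \<mu> = (obj \<alpha> + obj \<beta>) / 2 - c / 4 * ((W \<alpha> - W \<beta>) \<bullet> (W \<alpha> - W \<beta>))"
    by (simp add: obj_def \<mu>_def W_simps inner_add_left inner_add_right inner_diff_left
        inner_diff_right inner_commute field_simps)
  finally have "c * ((W \<alpha> - W \<beta>) \<bullet> (W \<alpha> - W \<beta>)) \<le> 0"
    using eq by simp
  then have "(W \<alpha> - W \<beta>) \<bullet> (W \<alpha> - W \<beta>) \<le> 0"
    using c_pos by (simp add: mult_le_0_iff)
  then show "W \<alpha> = W \<beta>"
    by (metis eq_iff_diff_eq_0 inner_ge_zero inner_eq_zero_iff order_antisym)
  with eq show "h \<bullet> \<alpha> = h \<bullet> \<beta>"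
    by (simp add: obj_def)
qed

section \<open>Optimality conditions as finitely many compact convex pieces\<close>

text \<open>
  The optimality conditions with the coordinates in \<open>P\<close> and \<open>N\<close> forced to the lower and upper bound.
  The sign conditions on the gradient are not strict, which makes the set closed.
\<close>

definition kkt :: "'n set \<Rightarrow> 'n set \<Rightarrow> (real \<times> (real^'n)) set" where
  "kkt P N = {z. fst z \<in> {0..1} \<and> snd z \<in> feas (fst z) \<and>
     (\<forall>i. (i \<in> P \<longrightarrow> snd z $ i \<le> 0) \<and> (i \<notin> P \<longrightarrow> grad (snd z) i \<le> 0) \<and>
          (i \<in> N \<longrightarrow> (u0 + fst z *\<^sub>R u1) $ i \<le> snd z $ i) \<and> (i \<notin> N \<longrightarrow> 0 \<le> grad (snd z) i))}"

lemma kkt_imp_opt: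
  assumes "(\<tau>, \<alpha>) \<in> kkt P N"
  shows "opt \<tau> \<alpha>"
  unfolding opt_iff
proof safe
  show "\<alpha> \<in> feas \<tau>"
    using assms by (simp add: kkt_def)
  fix \<beta> assume \<beta>: "\<beta> \<in> feas \<tau>"
  have "0 \<le> grad \<alpha> i * (\<beta> - \<alpha>) $ i" for i
  proof -
    have "0 \<le> \<beta> $ i" "\<beta> $ i \<le> (u0 + \<tau> *\<^sub>R u1) $ i" "0 \<le> \<alpha> $ i" "\<alpha> $ i \<le> (u0 + \<tau> *\<^sub>R u1) $ i"
      using \<beta> assms by (auto simp: kkt_def feas_def)
    moreover have "i \<in> P \<longrightarrow> \<alpha> $ i = 0" "i \<notin> P \<longrightarrow> grad \<alpha> i \<le> 0"
      "i \<in> N \<longrightarrow> \<alpha> $ i = (u0 + \<tau> *\<^sub>R u1) $ i" "i \<notin> N \<longrightarrow> 0 \<le> grad \<alpha> i"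
      using assms by (auto simp: kkt_def feas_def intro: antisym)
    \<comment> \<open>In neither set the gradient entry is 0. In both sets the two bounds coincide,
      so \<alpha> and \<beta> agree at \<open>i\<close>. Otherwise the gradient entry and the
      displacement have compatible signs.\<close>
    ultimately show ?thesis
      by (cases "i \<in> P"; cases "i \<in> N") (simp_all add: mult_nonpos_nonpos)
  qed
  then have "0 \<le> (\<Sum>i\<in>UNIV. grad \<alpha> i * (\<beta> - \<alpha>) $ i)"
    by (intro sum_nonneg) auto
  moreover have "0 \<le> c * (W (\<beta> - \<alpha>) \<bullet> W (\<beta> - \<alpha>))"
    using c_pos by simp
  ultimately show "obj \<alpha> \<le> obj \<beta>"
    using obj_add[of \<alpha> "\<beta> - \<alpha>"] by simp
qed

lemma opt_no_descent:
  assumes opt: "opt \<tau> \<alpha>" and feas: "\<alpha> + r *\<^sub>R axis i 1 \<in> feas \<tau>"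
  shows "0 \<le> r * grad \<alpha> i"
proof (rule ccontr)
  assume neg: "\<not> 0 \<le> r * grad \<alpha> i"
  define M where "M = r^2 * (c * (W (axis i 1) \<bullet> W (axis i 1)))"
  \<comment> \<open>The step stays on the feasible segment since \<open>s \<le> 1\<close>, and is
    short enough for the linear decrease to beat the quadratic term \<open>s * M\<close>. The
    summand 1 keeps the denominator positive and makes the comparison strict.\<close>
  define s where "s = min 1 (- (r * grad \<alpha> i) / (M + 1))"
  have M: "0 \<le> M"
    using c_pos by (simp add: M_def)
  have s: "0 < s" "s \<le> 1" "s \<le> - (r * grad \<alpha> i) / (M + 1)"
    using neg M divide_neg_pos[of "r * grad \<alpha> i" "M + 1"] by (auto simp: s_def)
  have "s * M < s * (M + 1)"
    using s by simp
  also have "\<dots> \<le> - (r * grad \<alpha> i)"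
    using s M pos_le_divide_eq[of "M + 1" s "- (r * grad \<alpha> i)"] by simp
  finally have "s * (r * grad \<alpha> i + s * M) < 0"
    using s by (simp add: mult_pos_neg)
  moreover have "obj (\<alpha> + (s * r) *\<^sub>R axis i 1) = obj \<alpha> + s * (r * grad \<alpha> i + s * M)"
    by (simp add: obj_add_axis M_def power2_eq_square algebra_simps)
  moreover have "\<alpha> + (s * r) *\<^sub>R axis i 1 = (1 - s) *\<^sub>R \<alpha> + s *\<^sub>R (\<alpha> + r *\<^sub>R axis i 1)"
    by (simp add: algebra_simps)
  moreover have "(1 - s) *\<^sub>R \<alpha> + s *\<^sub>R (\<alpha> + r *\<^sub>R axis i 1) \<in> feas ((1 - s) * \<tau> + s * \<tau>)"
    using opt feas s by (intro convex_feas) (simp_all add: opt_iff)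
  moreover have "(1 - s) * \<tau> + s * \<tau> = \<tau>"
    by (simp add: algebra_simps)
  ultimately show False
    using opt by (fastforce simp: opt_iff)
qed

lemma opt_imp_kkt:
  assumes opt: "opt \<tau> \<alpha>" and \<tau>: "\<tau> \<in> {0..1}"
  shows "(\<tau>, \<alpha>) \<in> kkt {i. grad \<alpha> i > 0} {i. grad \<alpha> i < 0}"
proof -
  have feas: "\<alpha> \<in> feas \<tau>"
    using opt by (simp add: opt_iff)
  have "\<alpha> $ i \<le> 0" if "grad \<alpha> i > 0" for i
  proof -
    \<comment> \<open>Moves coordinate \<open>i\<close> all the way to its lower bound; with a
      positive gradient entry this would be a descent unless the coordinate is already
      there.\<close>
    have "\<alpha> + (- (\<alpha> $ i)) *\<^sub>R axis i 1 \<in> feas \<tau>"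
      using feas upper_nonneg[OF \<tau>] by (auto simp: feas_def axis_def)
    from opt_no_descent[OF opt this] that show ?thesis
      by (simp add: mult_le_0_iff)
  qed
  moreover have "(u0 + \<tau> *\<^sub>R u1) $ i \<le> \<alpha> $ i" if "grad \<alpha> i < 0" for i
  proof -
    have "\<alpha> + ((u0 + \<tau> *\<^sub>R u1) $ i - \<alpha> $ i) *\<^sub>R axis i 1 \<in> feas \<tau>"
      using feas upper_nonneg[OF \<tau>] by (auto simp: feas_def axis_def)
    from opt_no_descent[OF opt this] that show ?thesis
      by (simp add: zero_le_mult_iff)
  qed
  ultimately show ?thesis
    using feas \<tau> by (auto simp: kkt_def not_less)
qed

lemma compact_kkt: "compact (kkt P N)"
proof -
  have "closed (kkt P N)"
    unfolding kkt_def feas_def grad_def atLeastAtMost_iff mem_Collect_eq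
    by (intro closed_Collect_conj closed_Collect_all closed_Collect_imp closed_Collect_le
        open_Collect_const continuous_intros)
  \<comment> \<open>For a parameter in the unit interval the absolute values of both coefficients
    bound the upper bound uniformly.\<close>
  moreover have "kkt P N \<subseteq> {0..1} \<times> cbox 0 (\<chi> i. \<bar>u0 $ i\<bar> + \<bar>u1 $ i\<bar>)"
  proof
    fix z assume z: "z \<in> kkt P N"
    have "0 \<le> snd z $ i \<and> snd z $ i \<le> \<bar>u0 $ i\<bar> + \<bar>u1 $ i\<bar>" for i
    proof -
      have "0 \<le> fst z" "fst z \<le> 1" "0 \<le> snd z $ i" "snd z $ i \<le> u0 $ i + fst z * u1 $ i"
        using z by (auto simp: kkt_def feas_def)
      moreover have "fst z * u1 $ i \<le> fst z * \<bar>u1 $ i\<bar>"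
        by (rule mult_left_mono[OF abs_ge_self]) fact
      moreover have "fst z * \<bar>u1 $ i\<bar> \<le> 1 * \<bar>u1 $ i\<bar>"
        by (rule mult_right_mono[OF _ abs_ge_zero]) fact
      ultimately show ?thesis
        by linarith
    qed
    then show "z \<in> {0..1} \<times> cbox 0 (\<chi> i. \<bar>u0 $ i\<bar> + \<bar>u1 $ i\<bar>)"
      using z by (simp add: mem_Times_iff mem_box_cart kkt_def)
  qed
  then have "bounded (kkt P N)"
    by (rule bounded_subset[OF bounded_Times[OF bounded_closed_interval bounded_cbox]])
  ultimately show ?thesis
    by (simp add: compact_eq_bounded_closed)
qed

text \<open>With \<open>P\<close> and \<open>N\<close> fixed, every condition compares affine
  functions of the pair of parameter and point.\<close>

lemma convex_kkt: "convex (kkt P N)"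
proof (rule convexI)
  fix z z' :: "real \<times> (real^'n)" and p q :: real
  assume z: "z \<in> kkt P N" and z': "z' \<in> kkt P N" and pq: "0 \<le> p" "0 \<le> q" "p + q = 1"
  obtain \<sigma> \<alpha> where za: "z = (\<sigma>, \<alpha>)"
    by fastforce
  obtain \<tau> \<beta> where zb: "z' = (\<tau>, \<beta>)"
    by fastforce
  have \<sigma>: "p * \<sigma> + q * \<tau> \<in> {0..1}"
    using convexD[of "{0..1::real}" \<sigma> \<tau> p q] z z' pq by (auto simp: za zb kkt_def)
  have feas: "p *\<^sub>R \<alpha> + q *\<^sub>R \<beta> \<in> feas (p * \<sigma> + q * \<tau>)"
    using convex_feas z z' pq by (auto simp: za zb kkt_def)
  \<comment> \<open>The gradient and the upper bound have constant terms, which split correctly only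
    because the weights sum to 1.\<close>
  have q: "q = 1 - p"
    using pq by simp
  have grad: "grad (p *\<^sub>R \<alpha> + q *\<^sub>R \<beta>) i = p * grad \<alpha> i + q * grad \<beta> i" for i
    by (simp add: grad_def W_simps inner_add_left q algebra_simps)
  have upper: "(u0 + (p * \<sigma> + q * \<tau>) *\<^sub>R u1) $ i
      = p * (u0 + \<sigma> *\<^sub>R u1) $ i + q * (u0 + \<tau> *\<^sub>R u1) $ i" for i
    by (simp add: q algebra_simps)
  have nonpos: "p * a + q * b \<le> 0" if "a \<le> 0" "b \<le> 0" for a b
    using pq that by (simp add: add_nonpos_nonpos mult_nonneg_nonpos)
  have add_scale: "(p *\<^sub>R \<alpha> + q *\<^sub>R \<beta>) $ i = p * \<alpha> $ i + q * \<beta> $ i" for i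
    by simp
  have nonneg: "0 \<le> p * a + q * b" if "0 \<le> a" "0 \<le> b" for a b
    using pq that by simp
  have mono: "p * a + q * b \<le> p * a' + q * b'" if "a \<le> a'" "b \<le> b'" for a b a' b'
    using pq that by (simp add: add_mono mult_left_mono)
  show "p *\<^sub>R z + q *\<^sub>R z' \<in> kkt P N"
    using z z' \<sigma> feas pq unfolding za zb kkt_def
    by (simp only: mem_Collect_eq fst_conv snd_conv grad upper add_scale scaleR_Pair add_Pair
        real_scaleR_def) (blast intro: nonpos nonneg mono)
qed

section \<open>Interpolating between breakpoints and assembling the path\<close>

lemma opt_interpolate:
  assumes sub: "{a..b} \<subseteq> fst ` kkt P N" and "a < b"
    and opt: "opt a \<alpha>" "opt b \<beta>" and \<tau>: "\<tau> \<in> {a..b}"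
  shows "opt \<tau> (\<alpha> + ((\<tau> - a) / (b - a)) *\<^sub>R (\<beta> - \<alpha>))"
proof -
  define q where "q = (\<tau> - a) / (b - a)"
  define p where "p = 1 - q"
  have pq: "0 \<le> p" "0 \<le> q" "p + q = 1"
    using \<tau> \<open>a < b\<close> by (auto simp: p_def q_def)
  have "\<tau> = a + q * (b - a)"
    using \<open>a < b\<close> by (simp add: q_def)
  then have \<tau>_eq: "\<tau> = p * a + q * b"
    by (simp add: p_def algebra_simps)
  have "a \<in> fst ` kkt P N" "b \<in> fst ` kkt P N"
    using sub \<open>a < b\<close> by auto
  \<comment> \<open>Auxiliary solutions with the same \<open>P\<close> and \<open>N\<close> at both
    ends: by convexity their combinations remain in one piece and are optimal. Exchanging them for
    \<alpha> and \<beta> preserves the objective by \<open>opt_unique\<close>.\<close>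
  then obtain \<alpha>' \<beta>' where kkt: "(a, \<alpha>') \<in> kkt P N" "(b, \<beta>') \<in> kkt P N"
    by auto
  have opt': "opt a \<alpha>'" "opt b \<beta>'"
    using kkt kkt_imp_opt by auto
  have "(\<tau>, p *\<^sub>R \<alpha>' + q *\<^sub>R \<beta>') \<in> kkt P N"
    using convexD[OF convex_kkt kkt pq] by (simp add: \<tau>_eq)
  then have *: "opt \<tau> (p *\<^sub>R \<alpha>' + q *\<^sub>R \<beta>')"
    using kkt_imp_opt by auto
  have "obj (p *\<^sub>R \<alpha> + q *\<^sub>R \<beta>) = obj (p *\<^sub>R \<alpha>' + q *\<^sub>R \<beta>')"
    using opt_unique[OF opt(1) opt'(1)] opt_unique[OF opt(2) opt'(2)]
    by (simp add: obj_def W_simps inner_add_right)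
  moreover have "p *\<^sub>R \<alpha> + q *\<^sub>R \<beta> \<in> feas \<tau>"
    using convex_feas opt pq by (simp add: \<tau>_eq opt_iff)
  ultimately have "opt \<tau> (p *\<^sub>R \<alpha> + q *\<^sub>R \<beta>)"
    using * by (simp add: opt_iff)
  moreover have "p *\<^sub>R \<alpha> + q *\<^sub>R \<beta> = \<alpha> + q *\<^sub>R (\<beta> - \<alpha>)"
    by (simp add: p_def algebra_simps)
  ultimately show ?thesis
    by (simp add: q_def)
qed

theorem piecewise_linear_solution_path:
  "\<exists>(K::nat) (t :: nat \<Rightarrow> real) (\<alpha> :: real \<Rightarrow> real^'n).
     2 \<le> K \<and> t 1 = 0 \<and> t K = 1 \<and> strict_mono_on {1..K} t \<and>
     (\<forall>\<tau>\<in>{0..1}. opt \<tau> (\<alpha> \<tau>)) \<and> continuous_on {0..1} \<alpha> \<and>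
     (\<forall>k\<in>{1..K-1}. \<exists>a b. \<forall>\<tau>\<in>{t k<..<t (k+1)}. \<alpha> \<tau> = a + \<tau> *\<^sub>R b)"
proof -
  define \<C> where "\<C> = range (\<lambda>(P, N). fst ` kkt P N)"
  have "finite \<C>"
    by (simp add: \<C>_def)
  moreover have "compact C \<and> convex C \<and> C \<subseteq> {0..1}" if C: "C \<in> \<C>" for C
  proof -
    obtain P N where "C = fst ` kkt P N"
      using C by (auto simp: \<C>_def)
    then show ?thesis
      using compact_continuous_image[OF continuous_on_fst[OF continuous_on_id] compact_kkt[of P N]]
        convex_linear_image[OF linear_fst convex_kkt[of P N]]
      by (auto simp: kkt_def split: prod.splits)
  qed
  moreover have "{0..1} \<subseteq> \<Union>\<C>"
  proof
    fix \<tau> :: real assume \<tau>: "\<tau> \<in> {0..1}"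
    obtain \<alpha> where "opt \<tau> \<alpha>"
      using opt_exists[OF \<tau>] .
    from opt_imp_kkt[OF this \<tau>] show "\<tau> \<in> \<Union>\<C>"
      by (force simp: \<C>_def)
  qed
  ultimately obtain K :: nat and t where K: "2 \<le> K" and t: "t 1 = 0" "t K = 1"
    and mono: "strict_mono_on {1..K} t"
    and cover: "\<And>k. k \<in> {1..K-1} \<Longrightarrow> \<exists>C\<in>\<C>. {t k..t (k+1)} \<subseteq> C"
    by (rule finite_interval_cover_partition[of \<C> 0 1]) simp_all
  have t_range: "t k \<in> {0..1}" if "k \<in> {1..K}" for k
    using strict_mono_on_leD[OF mono, of 1 k] strict_mono_on_leD[OF mono, of k K] that K t by auto
  \<comment> \<open>One choice per breakpoint, shared by both adjacent segments, so the pieces join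
    continuously.\<close>
  define v where "v k = (SOME \<alpha>. opt (t k) \<alpha>)" for k
  have v: "opt (t k) (v k)" if "k \<in> {1..K}" for k
    unfolding v_def using opt_exists[OF t_range[OF that]] by (metis someI_ex)
  define \<alpha> where "\<alpha> = pl_interp K t v"
  have \<alpha>_eq: "\<alpha> \<tau> = v k + ((\<tau> - t k) / (t (k+1) - t k)) *\<^sub>R (v (k+1) - v k)"
    if "k \<in> {1..K-1}" "\<tau> \<in> {t k..t (k+1)}" for k \<tau>
    unfolding \<alpha>_def using that K by (intro pl_interp_eq[OF mono]) auto
  have "opt \<tau> (\<alpha> \<tau>)" if \<tau>: "\<tau> \<in> {0..1}" for \<tau>
  proof -
    have "\<exists>k\<in>{1..K-1}. \<tau> \<in> {t k..t (k+1)}"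
    proof -
      \<comment> \<open>The index is capped at \<open>K-1\<close> so that the parameter 1 falls into
        the last segment.\<close>
      define k where "k = Max {k \<in> {1..K-1}. t k \<le> \<tau>}"
      have ne: "finite {k \<in> {1..K-1}. t k \<le> \<tau>}" "{k \<in> {1..K-1}. t k \<le> \<tau>} \<noteq> {}"
        using K t \<tau> by (auto intro!: exI[of _ 1])
      have k: "k \<in> {1..K-1}" "t k \<le> \<tau>"
        using Max_in[OF ne] by (auto simp: k_def)
      have "\<tau> \<le> t (k+1)"
      proof (cases "k + 1 = K")
        case True
        then show ?thesis using t \<tau> by auto
      next
        case False
        show ?thesis
        proof (rule ccontr)
          assume "\<not> \<tau> \<le> t (k+1)"
          with False k have "k + 1 \<in> {k \<in> {1..K-1}. t k \<le> \<tau>}"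
            by auto
          from Max_ge[OF ne(1) this] show False
            by (simp add: k_def)
        qed
      qed
      with k show ?thesis
        by auto
    qed
    then obtain k where k: "k \<in> {1..K-1}" "\<tau> \<in> {t k..t (k+1)}"
      by blast
    obtain P N where "{t k..t (k+1)} \<subseteq> fst ` kkt P N"
      using cover[OF k(1)] by (auto simp: \<C>_def)
    moreover have "t k < t (k+1)"
      using k by (intro strict_mono_onD[OF mono]) auto
    moreover have "opt (t k) (v k)" "opt (t (k+1)) (v (k+1))"
      using k by (auto intro!: v)
    ultimately show ?thesis
      unfolding \<alpha>_eq[OF k] using k by (intro opt_interpolate)
  qed
  moreover have "continuous_on {0..1} \<alpha>"
    unfolding \<alpha>_def by (rule continuous_on_pl_interp)
  moreover have "\<exists>a b. \<forall>\<tau>\<in>{t k<..<t (k+1)}. \<alpha> \<tau> = a + \<tau> *\<^sub>R b" if k: "k \<in> {1..K-1}" for k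
  proof -
    define b where "b = (1 / (t (k+1) - t k)) *\<^sub>R (v (k+1) - v k)"
    have "\<alpha> \<tau> = (v k - t k *\<^sub>R b) + \<tau> *\<^sub>R b" if "\<tau> \<in> {t k<..<t (k+1)}" for \<tau>
    proof -
      have "\<alpha> \<tau> = v k + (\<tau> - t k) *\<^sub>R b"
        using \<alpha>_eq[OF k, of \<tau>] that by (simp add: b_def)
      then show ?thesis
        by (simp add: algebra_simps)
    qed
    then show ?thesis
      by blast
  qed
  ultimately show ?thesis
    using K t mono by blast
qed

end

section \<open>The dual of the quantile classification problem\<close>

text \<open>The dual matrix is the Gram matrix of the vectors \<open>y i *\<^sub>R x i\<close>; this
  supplies the factor \<open>W\<close>.\<close>

lemma inner_dual_matrix:
  "\<alpha> \<bullet> (dual_matrix x y *v \<alpha>)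
     = (\<Sum>i\<in>UNIV. (\<alpha> $ i * y i) *\<^sub>R x i) \<bullet> (\<Sum>i\<in>UNIV. (\<alpha> $ i * y i) *\<^sub>R x i)"
  by (simp add: inner_vec_def[of \<alpha>] dual_matrix_def matrix_vector_mult_def inner_sum_left
      inner_sum_right[of "x _"] sum_distrib_left mult_ac)

theorem proposition3p1:
  fixes lam :: real
    and x :: "'n::finite \<Rightarrow> real^'d"
    and y :: "'n \<Rightarrow> real"
  assumes "lam > 0"
    and "\<And>i. y i \<in> {1, -1}"
  shows "\<exists>(K::nat) (t :: nat \<Rightarrow> real) (\<alpha> :: real \<Rightarrow> real^'n).
           2 \<le> K \<and> t 1 = 0 \<and> t K = 1 \<and> strict_mono_on {1..K} t \<and>
           (\<forall>\<tau>\<in>{0..1}. dual_optimal lam x y \<tau> (\<alpha> \<tau>)) \<and>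
           continuous_on {0..1} \<alpha> \<and>
           (\<forall>k\<in>{1..K-1}. \<exists>a b. \<forall>\<tau>\<in>{t k<..<t (k+1)}. \<alpha> \<tau> = a + \<tau> *\<^sub>R b)"
proof -
  define W :: "real^'n \<Rightarrow> real^'d" where "W \<alpha> = (\<Sum>i\<in>UNIV. (\<alpha> $ i * y i) *\<^sub>R x i)" for \<alpha>
  \<comment> \<open>The constant and linear coefficients of the class costs as polynomials in
    \<tau>.\<close>
  define u0 u1 :: "real^'n"
    where "u0 = (\<chi> i. if y i = 1 then 2 / CARD('n) else 0)"
      and "u1 = (\<chi> i. if y i = 1 then - 2 / CARD('n) else 2 / CARD('n))"
  have upper: "(u0 + \<tau> *\<^sub>R u1) $ i = class_cost CARD('n) \<tau> (y i)" for \<tau> i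
    by (simp add: u0_def u1_def class_cost_def field_simps)
  interpret parametric_box_qp W "1 / (2 * lam)" "\<chi> i. 1" u0 u1
  proof (rule parametric_box_qp.intro)
    show "linear W"
      unfolding W_def
      by (rule linearI) (simp_all add: algebra_simps sum.distrib scaleR_sum_right)
    show "0 < 1 / (2 * lam)"
      using assms by simp
    show "0 \<le> (u0 + \<tau> *\<^sub>R u1) $ i" if "\<tau> \<in> {0..1}" for \<tau> i
      unfolding upper class_cost_def using that by simp
  qed
  have "dual_objective lam x y = obj"
    by (rule ext) (simp add: dual_objective_def obj_def inner_dual_matrix W_def inner_commute)
  moreover have "dual_feasible y \<tau> = feas \<tau>" for \<tau>
    unfolding dual_feasible_def feas_def upper ..
  ultimately have "dual_optimal lam x y \<tau> = opt \<tau>" for \<tau>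
    by (auto simp: dual_optimal_def opt_def)
  then show ?thesis
    using piecewise_linear_solution_path by simp
qed

end
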